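(* Let $\mathbb{P}$ be a $\sigma$-finite stationary measure on $\Omega$. Then the Palm measure of the exceedance measure $\xi$ of $Y$ with respect to $\mathbb{P}$ is $$\mathbb{P}_\xi=\mathbb{P}(\cdot\cap\{|Y_0|>1\}).$$
   Context: $\mathbb{G}$ is a locally compact Hausdorff Abelian group (written additively, neutral element $0$) with Borel $\sigma$-field $\mathcal{G}$ and non-trivial Haar measure $\lambda$. $(\Omega,\mathcal{A})$ is a measurable space with a measurable flow $\{\theta_s:s\in\mathbb{G}\}$: maps $\theta_s\colon\Omega\to\Omega$ such that $(\omega,s)\mapsto\theta_s\omega$ is measurable, $\theta_0$ is the identity, and $\theta_s\circ\theta_t=\theta_{s+t}$. A measure $\mathbb{P}$ on $(\Omega,\mathcal{A})$ is stationary if $\mathbb{P}(\theta_sA)=\mathbb{P}(A)$ for all $s\in\mathbb{G}$, $A\in\mathcal{A}$. $\mathbb{H}$ is a non-empty Polish space with its Borel $\sigma$-field, $|\cdot|\colon\mathbb{H}\to[0,\infty)$ is a measurable map, and $Y\colon\Omega\times\mathbb{G}\to\mathbb{H}$ is measurable; write $Y_s(\omega)=Y(\omega,s)$. It is assumed that $Y_s(\theta_t\omega)=Y_{s+t}(\omega)$ for all $\omega\in\Omega$, $s,t\in\mathbb{G}$. The exceedance measure of $Y$ is the random measure $\xi:=\int\mathbf 1\{s\in\cdot,\ |Y_s|>1\}\,\lambda(ds)$ on $\mathbb{G}$. It satisfies $\xi(\omega,B+s)=\xi(\theta_s\omega,B)$ (invariance). The Palm measure of $\xi$ with respect to $\mathbb{P}$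 is $$\mathbb{P}_\xi(A):=\lambda(B)^{-1}\iint\mathbf 1_A(\theta_s\omega)\mathbf 1_B(s)\,\xi(\omega,ds)\,\mathbb{P}(d\omega),\quad A\in\mathcal{A},$$ where $B\in\mathcal{G}$ is any set with $0<\lambda(B)<\infty$ (the definition does not depend on $B$). *)

theory Defs
  imports "HOL-Analysis.Analysis"
begin

text \<open>
  A Haar measure: a nonzero translation-invariant Radon measure on the Borel sets. Since the group
  need not be second countable, ``Radon'' is spelled out: finite on compact sets, outer regular on
  Borel sets and inner regular on open sets.
\<close>

definition haar_measure :: "'g :: {topological_ab_group_add, t2_space} measure \<Rightarrow> bool" where
  "haar_measure \<mu> \<longleftrightarrow>
     sets \<mu> = sets borel \<and>
     emeasure \<mu> UNIV \<noteq> 0 \<and>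
     (\<forall>t. \<forall>B\<in>sets borel. emeasure \<mu> ((\<lambda>s. s + t) ` B) = emeasure \<mu> B) \<and>
     (\<forall>K. compact K \<longrightarrow> emeasure \<mu> K < \<infinity>) \<and>
     (\<forall>B\<in>sets borel. emeasure \<mu> B = (INF U\<in>{U. open U \<and> B \<subseteq> U}. emeasure \<mu> U)) \<and>
     (\<forall>U. open U \<longrightarrow>
        emeasure \<mu> U = (SUP K\<in>{K. compact K \<and> K \<subseteq> U}. emeasure \<mu> K))"

text \<open>
  The set \<open>B\<close> used to normalise the Palm measure below always exists.
\<close>

lemma haar_measure_normalising_set:
  assumes "haar_measure \<mu>"
  shows "\<exists>B\<in>sets borel. 0 < emeasure \<mu> B \<and> emeasure \<mu> B < \<infinity>"
proof -
  have pos: "emeasure \<mu> UNIV \<noteq> 0"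
    and fin: "\<forall>K. compact K \<longrightarrow> emeasure \<mu> K < \<infinity>"
    and reg: "\<forall>U. open U \<longrightarrow>
        emeasure \<mu> U = (SUP K\<in>{K. compact K \<and> K \<subseteq> U}. emeasure \<mu> K)"
    using assms unfolding haar_measure_def by - (elim conjE, assumption)+
  have "0 < emeasure \<mu> UNIV"
    using pos by (simp only: zero_less_iff_neq_zero not_False_eq_True)
  also have "emeasure \<mu> UNIV = (SUP K\<in>{K. compact K \<and> K \<subseteq> UNIV}. emeasure \<mu> K)"
    by (rule reg[rule_format, OF open_UNIV])
  finally obtain K where K: "compact K" "0 < emeasure \<mu> K"
    by (auto simp: less_SUP_iff)
  show ?thesis
  proof (intro bexI conjI)
    show "K \<in> sets borel"
      using K(1) by (intro borel_closed compact_imp_closed)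
  qed (use K fin in simp_all)
qed

definition measurable_flow :: "'w measure \<Rightarrow> ('g :: topological_ab_group_add \<Rightarrow> 'w \<Rightarrow> 'w) \<Rightarrow> bool" where
  "measurable_flow M \<theta> \<longleftrightarrow>
     (\<lambda>(\<omega>, s). \<theta> s \<omega>) \<in> M \<Otimes>\<^sub>M borel \<rightarrow>\<^sub>M M \<and>
     (\<forall>\<omega>\<in>space M. \<theta> 0 \<omega> = \<omega>) \<and>
     (\<forall>s t. \<forall>\<omega>\<in>space M. \<theta> s (\<theta> t \<omega>) = \<theta> (s + t) \<omega>)"

definition stationary :: "('g \<Rightarrow> 'w \<Rightarrow> 'w) \<Rightarrow> 'w measure \<Rightarrow> bool" where
  "stationary \<theta> P \<longleftrightarrow> (\<forall>s. \<forall>A\<in>sets P. emeasure P (\<theta> s ` A) = emeasure P A)"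

definition exceedance_measure ::
  "'g measure \<Rightarrow> ('h \<Rightarrow> real) \<Rightarrow> ('w \<Rightarrow> 'g \<Rightarrow> 'h) \<Rightarrow> 'w \<Rightarrow> 'g measure" where
  "exceedance_measure \<mu> mag Y \<omega> = density \<mu> (indicator {s. mag (Y \<omega> s) > 1})"

text \<open>
  The Palm measure of a random measure \<open>\<xi>\<close>, computed with the normalising set \<open>B\<close>. Note that
  \<^const>\<open>measure_of\<close> yields the null measure if the given set function is not countably additive.
\<close>

definition palm_measure ::
  "('g \<Rightarrow> 'w \<Rightarrow> 'w) \<Rightarrow> 'g measure \<Rightarrow> 'w measure \<Rightarrow> ('w \<Rightarrow> 'g measure) \<Rightarrow> 'g set \<Rightarrow> 'w measure" where
  "palm_measure \<theta> \<mu> P \<xi> B = measure_of (space P) (sets P)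
     (\<lambda>A. inverse (emeasure \<mu> B) *
        (\<integral>\<^sup>+\<omega>. (\<integral>\<^sup>+s. indicator A (\<theta> s \<omega>) * indicator B s \<partial>\<xi> \<omega>) \<partial>P))"

end

theory Submission
  imports Defs
begin

text \<open>
  Invariance of \<open>Y\<close> gives \<open>Y\<^sub>s(\<omega>) = Y\<^sub>0(\<theta>\<^sub>s \<omega>)\<close>, so the integrand defining the Palm measure at \<open>A\<close> is
  \<open>1\<^sub>B(s)\<close> times the indicator of \<open>A \<inter> {|Y\<^sub>0| > 1}\<close> at \<open>\<theta>\<^sub>s \<omega>\<close>. Fubini and stationarity then produce the
  factor \<open>\<lambda>(B)\<close>, which the normalisation cancels. A Haar measure need not be \<open>\<sigma>\<close>-finite, but only its
  restriction to \<open>B\<close>, a finite measure, enters.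
\<close>

lemma measurable_flow_measurable_pair:
  assumes "measurable_flow M \<theta>"
  shows "(\<lambda>(\<omega>, s). \<theta> s \<omega>) \<in> M \<Otimes>\<^sub>M borel \<rightarrow>\<^sub>M M"
  using assms by (simp add: measurable_flow_def)

lemma measurable_flow_measurable:
  assumes "measurable_flow M \<theta>"
  shows "\<theta> s \<in> M \<rightarrow>\<^sub>M M"
  using measurable_Pair2'[of s borel M]
    measurable_compose[OF _ measurable_flow_measurable_pair[OF assms], of "\<lambda>\<omega>. (\<omega>, s)" M]
  by simp

text \<open>Stationarity is phrased with images, while integrating along the flow produces
  preimages. The flow law makes \<open>\<theta> s\<close> and \<open>\<theta> (- s)\<close> mutually
  inverse on \<open>space M\<close>, so stationarity at \<open>- s\<close> controls preimages under
  \<open>\<theta> s\<close>.\<close>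

lemma measurable_flow_image_uminus:
  assumes flow: "measurable_flow M \<theta>" and A: "A \<in> sets M"
  shows "\<theta> (- s) ` A = \<theta> s -` A \<inter> space M"
proof -
  have cancel: "\<theta> s (\<theta> (- s) \<omega>) = \<omega>" "\<theta> (- s) (\<theta> s \<omega>) = \<omega>" if "\<omega> \<in> space M" for \<omega>
    using flow that by (simp_all add: measurable_flow_def)
  have "\<theta> (- s) \<omega> \<in> space M" if "\<omega> \<in> space M" for \<omega>
    using measurable_space[OF measurable_flow_measurable[OF flow] that] .
  then show ?thesis
    using cancel sets.sets_into_space[OF A] by (auto simp: image_iff) metis
qed

lemma stationary_emeasure_vimage:
  assumes "measurable_flow M \<theta>" "stationary \<theta> P" "sets P = sets M" "A \<in> sets M"
  shows "emeasure P (\<theta> s -` A \<inter> space M) = emeasure P A"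
  using assms by (simp add: measurable_flow_image_uminus[symmetric] stationary_def)

text \<open>Sigma-finiteness of both measures permits integrating over \<open>P\<close> first; by
  stationarity that integral is the same for every \<open>s\<close>, so \<open>\<nu>\<close>
  contributes only its total mass.\<close>

lemma nn_integral_flow_indicator:
  assumes flow: "measurable_flow M \<theta>" and stat: "stationary \<theta> P"
    and sets_P: "sets P = sets M" and P: "sigma_finite_measure P"
    and sets_\<nu>: "sets \<nu> = sets borel" and \<nu>: "sigma_finite_measure \<nu>"
    and A: "A \<in> sets M"
  shows "(\<integral>\<^sup>+\<omega>. (\<integral>\<^sup>+s. indicator A (\<theta> s \<omega>) \<partial>\<nu>) \<partial>P) = emeasure P A * emeasure \<nu> (space \<nu>)"
proof -
  interpret P: sigma_finite_measure P by fact
  interpret \<nu>: sigma_finite_measure \<nu> by fact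
  interpret pair_sigma_finite P \<nu> ..
  have "(\<lambda>(\<omega>, s). \<theta> s \<omega>) \<in> P \<Otimes>\<^sub>M \<nu> \<rightarrow>\<^sub>M M"
    using measurable_flow_measurable_pair[OF flow] sets_P sets_\<nu>
    by (simp cong: measurable_cong_sets sets_pair_measure_cong)
  from measurable_compose[OF this borel_measurable_indicator[OF A]]
  have "(\<lambda>(\<omega>, s). indicator A (\<theta> s \<omega>) :: ennreal) \<in> borel_measurable (P \<Otimes>\<^sub>M \<nu>)"
    by (simp add: case_prod_unfold)
  then have "(\<integral>\<^sup>+\<omega>. (\<integral>\<^sup>+s. indicator A (\<theta> s \<omega>) \<partial>\<nu>) \<partial>P) =
      (\<integral>\<^sup>+s. (\<integral>\<^sup>+\<omega>. indicator A (\<theta> s \<omega>) \<partial>P) \<partial>\<nu>)"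
    by (rule Fubini'[symmetric])
  also have "\<dots> = (\<integral>\<^sup>+s. emeasure P A \<partial>\<nu>)"
  proof (rule nn_integral_cong)
    fix s
    \<comment> \<open>The preimage is cut down to \<open>space M\<close> because
      \<open>\<theta> s\<close> is unconstrained outside it; on \<open>space P\<close> both
      integrands agree.\<close>
    have "(\<integral>\<^sup>+\<omega>. indicator A (\<theta> s \<omega>) \<partial>P) =
        (\<integral>\<^sup>+\<omega>. indicator (\<theta> s -` A \<inter> space M) \<omega> \<partial>P)"
      using sets_eq_imp_space_eq[OF sets_P]
      by (intro nn_integral_cong) (simp add: indicator_def)
    also have "\<dots> = emeasure P (\<theta> s -` A \<inter> space M)"
      using measurable_sets[OF measurable_flow_measurable[OF flow] A] sets_P by simp
    also have "\<dots> = emeasure P A"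
      by (rule stationary_emeasure_vimage[OF flow stat sets_P A])
    finally show "(\<integral>\<^sup>+\<omega>. indicator A (\<theta> s \<omega>) \<partial>P) = emeasure P A" .
  qed
  finally show ?thesis by simp
qed

theorem lemma4p1:
  fixes \<mu> :: "'g :: {topological_ab_group_add, t2_space} measure"
    and M P :: "'w measure"
    and \<theta> :: "'g \<Rightarrow> 'w \<Rightarrow> 'w"
    and mag :: "'h :: polish_space \<Rightarrow> real"
    and Y :: "'w \<Rightarrow> 'g \<Rightarrow> 'h"
    and B :: "'g set"
  assumes "locally_compact_space (euclidean :: 'g topology)"
    and "haar_measure \<mu>"
    and "measurable_flow M \<theta>"
    and "mag \<in> borel_measurable borel" and "\<And>y. 0 \<le> mag y"
    and "(\<lambda>(\<omega>, s). Y \<omega> s) \<in> borel_measurable (M \<Otimes>\<^sub>M borel)"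
    and "\<And>\<omega> s t. \<omega> \<in> space M \<Longrightarrow> Y (\<theta> t \<omega>) s = Y \<omega> (s + t)"
    and "sets P = sets M" and "sigma_finite_measure P" and "stationary \<theta> P"
    and "B \<in> sets borel" and "0 < emeasure \<mu> B" and "emeasure \<mu> B < \<infinity>"
  shows "sets (palm_measure \<theta> \<mu> P (exceedance_measure \<mu> mag Y) B) = sets M \<and>
    (\<forall>A\<in>sets M.
      emeasure (palm_measure \<theta> \<mu> P (exceedance_measure \<mu> mag Y) B) A
        = emeasure P (A \<inter> {\<omega> \<in> space M. mag (Y \<omega> 0) > 1}))"
proof -
  note sets_\<mu> = assms(2)[unfolded haar_measure_def, THEN conjunct1]
  note Y_meas = assms(6) and Y_shift = assms(7) and sets_P = assms(8)
  note B = assms(11) and B_pos = assms(12) and B_fin = assms(13)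
  have space_P: "space P = space M"
    by (rule sets_eq_imp_space_eq[OF sets_P])
  define E where "E = {\<omega> \<in> space M. mag (Y \<omega> 0) > 1}"
  have "(\<lambda>\<omega>. mag (Y \<omega> 0)) \<in> borel_measurable M"
    using measurable_compose[OF measurable_compose[OF measurable_Pair2'[of 0 borel M] Y_meas] assms(4)]
    by simp
  then have E: "E \<in> sets M"
    unfolding E_def by simp
  have B_\<mu> [measurable]: "B \<in> sets \<mu>"
    using B sets_\<mu> by simp
  define \<nu> where "\<nu> = density \<mu> (indicator B)"
  have sets_\<nu>: "sets \<nu> = sets borel"
    by (simp add: \<nu>_def sets_\<mu>)
  \<comment> \<open>This total mass serves twice: its finiteness makes \<open>\<nu>\<close>
    admissible for Fubini, and its value is the factor that the normalisation cancels.\<close>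
  have \<nu>_space: "emeasure \<nu> (space \<nu>) = emeasure \<mu> B"
    using emeasure_restricted[OF B_\<mu> sets.top] sets.sets_into_space[OF B_\<mu>]
    by (simp add: \<nu>_def Int_absorb2)
  have "finite_measure \<nu>"
    using B_fin \<nu>_space by (intro finite_measureI) simp
  then have \<nu>: "sigma_finite_measure \<nu>"
    by (simp add: finite_measure_def)
  \<comment> \<open>For fixed \<open>\<omega>\<close> two factors trade places: the exceedance
    condition leaves the measure and joins the integrand as \<open>E\<close>, while \<open>B\<close>
    leaves the integrand and becomes the density of \<open>\<nu>\<close>.\<close>
  have inner: "(\<integral>\<^sup>+s. indicator A (\<theta> s \<omega>) * indicator B s \<partial>exceedance_measure \<mu> mag Y \<omega>) =
      (\<integral>\<^sup>+s. indicator (A \<inter> E) (\<theta> s \<omega>) \<partial>\<nu>)" if A: "A \<in> sets M" and \<omega>: "\<omega> \<in> space M" for A \<omega>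
  proof -
    have \<theta>_meas: "(\<lambda>s. \<theta> s \<omega>) \<in> \<mu> \<rightarrow>\<^sub>M M"
      using measurable_compose[OF measurable_Pair1'[OF \<omega>]
          measurable_flow_measurable_pair[OF assms(3)]] sets_\<mu>
      by (simp cong: measurable_cong_sets)
    have exceed: "{s. mag (Y \<omega> s) > 1} \<in> sets \<mu>"
    proof -
      have "(\<lambda>s. mag (Y \<omega> s)) \<in> borel_measurable borel"
        using measurable_compose[OF measurable_compose[OF measurable_Pair1'[OF \<omega>] Y_meas] assms(4)]
        by simp
      then have "{s \<in> space borel. mag (Y \<omega> s) > 1} \<in> sets borel"
        by (rule borel_measurable_less[OF borel_measurable_const])
      then show ?thesis by (simp add: sets_\<mu>)
    qed
    have [measurable]: "(\<lambda>s. indicator C (\<theta> s \<omega>) :: ennreal) \<in> borel_measurable \<mu>"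
      if "C \<in> sets M" for C
      by (rule measurable_compose[OF \<theta>_meas borel_measurable_indicator[OF that]])
    have "(\<integral>\<^sup>+s. indicator A (\<theta> s \<omega>) * indicator B s \<partial>exceedance_measure \<mu> mag Y \<omega>) =
        (\<integral>\<^sup>+s. indicator {s. mag (Y \<omega> s) > 1} s * (indicator A (\<theta> s \<omega>) * indicator B s) \<partial>\<mu>)"
      unfolding exceedance_measure_def using exceed A by (intro nn_integral_density) auto
    \<comment> \<open>Here the shift rule is used as
      \<open>Y (\<theta> s \<omega>) 0 = Y \<omega> s\<close>, so exceedance at \<open>s\<close>
      means \<open>\<theta> s \<omega> \<in> E\<close>; as \<open>E\<close> lies in
      \<open>space M\<close>, it also matters that the flow preserves
      \<open>space M\<close>.\<close>
    also have "\<dots> = (\<integral>\<^sup>+s. indicator B s * indicator (A \<inter> E) (\<theta> s \<omega>) \<partial>\<mu>)"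
      using Y_shift[OF \<omega>, of _ 0] measurable_space[OF measurable_flow_measurable[OF assms(3)] \<omega>]
      by (intro nn_integral_cong) (simp add: E_def indicator_def)
    also have "\<dots> = (\<integral>\<^sup>+s. indicator (A \<inter> E) (\<theta> s \<omega>) \<partial>\<nu>)"
      unfolding \<nu>_def using A E by (intro nn_integral_density[symmetric]) auto
    finally show ?thesis .
  qed
  have density: "emeasure (density P (indicator E)) A = emeasure P (A \<inter> E)" if "A \<in> sets M" for A
    using that E by (simp add: emeasure_restricted sets_P Int_commute)
  \<comment> \<open>Both bounds on \<open>emeasure \<mu> B\<close> enter: in \<open>ennreal\<close>
    this product is 0 when the mass is 0 or infinite.\<close>
  have cancel: "inverse (emeasure \<mu> B) * emeasure \<mu> B = 1"
    using B_pos B_fin ennreal_divide_self[of "emeasure \<mu> B"]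
    by (simp add: divide_ennreal_def mult.commute)
  \<comment> \<open>It suffices to match the set functions on measurable sets. The right-hand one
    comes from an actual measure, so countable additivity is inherited and \<open>measure_of\<close>
    does not fall back to the null measure.\<close>
  have "palm_measure \<theta> \<mu> P (exceedance_measure \<mu> mag Y) B =
      measure_of (space P) (sets P) (emeasure (density P (indicator E)))"
    unfolding palm_measure_def
  proof (rule measure_of_eq[OF sets.space_closed])
    fix A assume "A \<in> sigma_sets (space P) (sets P)"
    then have A: "A \<in> sets M"
      using sets.sigma_sets_eq[of P] sets_P by simp
    have "(\<integral>\<^sup>+\<omega>. (\<integral>\<^sup>+s. indicator A (\<theta> s \<omega>) * indicator B s \<partial>exceedance_measure \<mu> mag Y \<omega>) \<partial>P) =
        (\<integral>\<^sup>+\<omega>. (\<integral>\<^sup>+s. indicator (A \<inter> E) (\<theta> s \<omega>) \<partial>\<nu>) \<partial>P)"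
      using inner[OF A] by (intro nn_integral_cong) (simp add: space_P)
    also have "\<dots> = emeasure P (A \<inter> E) * emeasure \<mu> B"
      using nn_integral_flow_indicator[OF assms(3,10) sets_P assms(9) sets_\<nu> \<nu>, of "A \<inter> E"]
        A E \<nu>_space by auto
    finally show "inverse (emeasure \<mu> B) *
        (\<integral>\<^sup>+\<omega>. (\<integral>\<^sup>+s. indicator A (\<theta> s \<omega>) * indicator B s \<partial>exceedance_measure \<mu> mag Y \<omega>) \<partial>P) =
        emeasure (density P (indicator E)) A"
      using density[OF A] cancel by (simp add: mult.commute[of "emeasure P _"] flip: mult.assoc)
  qed
  also have "\<dots> = density P (indicator E)"
    using measure_of_of_measure[of "density P (indicator E)"] by simp
  finally show ?thesis
    using density sets_P by (simp add: E_def)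
qed

end
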